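(* Let $D$ and $G$ be two Sullivan-tight orientations. Then the lexicographic product $D[G]$ is also a Sullivan-tight orientation.
   Context: All directed graphs are finite, with non-empty vertex set, and without loops or multiple arcs. An orientation is a directed graph with no directed cycle of length 2. For a directed graph $G$ and $v\in V(G)$: $N^+_1(G,v)=\{w : (v,w)\in E(G)\}$, $N^-_1(G,v)=\{u : (u,v)\in E(G)\}$, and $N^+_2(G,v)=\{w\in V(G)\setminus(N^+_1(G,v)\cup\{v\}) : \exists u\in N^+_1(G,v),\ (u,w)\in E(G)\}$. An orientation $G$ is Sullivan-tight if $|N^-_1(G,v)|=|N^+_2(G,v)|$ for all $v\in V(G)$. The lexicographic product $D[G]$ has vertex set $V(D)\times V(G)$, with an arc from $(v,i)$ to $(w,j)$ iff $(v,w)\in E(D)$, or $v=w$ and $(i,j)\in E(G)$. *)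

theory Defs
  imports "Graph_Theory.Graph_Theory"
begin

text \<open>
  A finite directed graph without loops or multiple arcs is a record
  \<^typ>\<open>'a pair_pre_digraph\<close> satisfying the locale \<^locale>\<open>pair_digraph\<close>. That locale
  allows the empty vertex set, so non-emptiness is required separately.
\<close>

definition orientation :: "'a pair_pre_digraph \<Rightarrow> bool" where
  "orientation G \<longleftrightarrow> pair_digraph G \<and> pverts G \<noteq> {} \<and>
     \<not> (\<exists>p. pre_digraph.cycle (with_proj G) p \<and> length p = 2)"

definition out_nbrs :: "'a pair_pre_digraph \<Rightarrow> 'a \<Rightarrow> 'a set" where
  "out_nbrs G v = {w. (v, w) \<in> parcs G}"

definition in_nbrs :: "'a pair_pre_digraph \<Rightarrow> 'a \<Rightarrow> 'a set" where
  "in_nbrs G v = {u. (u, v) \<in> parcs G}"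

definition second_out_nbrs :: "'a pair_pre_digraph \<Rightarrow> 'a \<Rightarrow> 'a set" where
  "second_out_nbrs G v =
     {w \<in> pverts G - (out_nbrs G v \<union> {v}). \<exists>u \<in> out_nbrs G v. (u, w) \<in> parcs G}"

definition sullivan_tight :: "'a pair_pre_digraph \<Rightarrow> bool" where
  "sullivan_tight G \<longleftrightarrow>
     (\<forall>v \<in> pverts G. card (in_nbrs G v) = card (second_out_nbrs G v))"

definition lexicographic_product ::
    "'a pair_pre_digraph \<Rightarrow> 'b pair_pre_digraph \<Rightarrow> ('a \<times> 'b) pair_pre_digraph" where
  "lexicographic_product D G =
     \<lparr> pverts = pverts D \<times> pverts G,
       parcs = {((v, i), (w, j)) | v i w j.
         v \<in> pverts D \<and> w \<in> pverts D \<and> i \<in> pverts G \<and> j \<in> pverts G \<and>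
         ((v, w) \<in> parcs D \<or> v = w \<and> (i, j) \<in> parcs G)} \<rparr>"

end

theory Submission
  imports Defs
begin

text \<open>Both the in-neighbourhood and the second out-neighbourhood of \<open>(v, i)\<close>
  split along the copy of \<open>G\<close> at \<open>v\<close>: outside it they consist of whole
  copies of \<open>G\<close> over the corresponding set of \<open>v\<close> in \<open>D\<close>,
  inside it they are the corresponding set of \<open>i\<close> in \<open>G\<close>
  (\<open>in_nbrs_lexicographic_product\<close>,
  \<open>second_out_nbrs_lexicographic_product\<close>). So each has size a * |V(G)| + b, and
  tightness of \<open>D\<close> and of \<open>G\<close> makes the values of a and of b
  agree.\<close>

text \<open>Trades cycles of length 2 for antisymmetry of the arc relation, which can be checked on
  single arcs of the product.\<close>

lemma orientation_iff:
  "orientation G \<longleftrightarrow> pair_digraph G \<and> pverts G \<noteq> {} \<and>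
     (\<forall>u v. (u, v) \<in> parcs G \<longrightarrow> (v, u) \<notin> parcs G)"
proof (cases "pair_digraph G")
  case True
  then interpret pair_digraph G .
  have "(\<exists>p. cycle p \<and> length p = 2) \<longleftrightarrow> (\<exists>u v. (u, v) \<in> parcs G \<and> (v, u) \<in> parcs G)"
  proof
    assume "\<exists>p. cycle p \<and> length p = 2"
    then obtain a b where "cycle [a, b]"
      by (auto simp: length_Suc_conv numeral_2_eq_2)
    then show "\<exists>u v. (u, v) \<in> parcs G \<and> (v, u) \<in> parcs G"
      by (cases a; cases b) (auto simp: cycle_def awalk_def cas.simps)
  next
    assume "\<exists>u v. (u, v) \<in> parcs G \<and> (v, u) \<in> parcs G"
    then obtain u v where uv: "(u, v) \<in> parcs G" "(v, u) \<in> parcs G" by blast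
    \<comment> \<open>\<open>cycle\<close> demands distinct vertices, hence the appeal to
      \<open>no_loops\<close>.\<close>
    then have "u \<noteq> v" "u \<in> pverts G" "v \<in> pverts G"
      using no_loops wellformed by fastforce+
    with uv have "cycle [(u, v), (v, u)]"
      by (auto simp: cycle_def awalk_def cas.simps)
    then show "\<exists>p. cycle p \<and> length p = 2"
      by (intro exI[of _ "[(u, v), (v, u)]"]) simp
  qed
  with True show ?thesis by (auto simp: orientation_def)
qed (simp add: orientation_def)

lemma orientation_lexicographic_product:
  assumes "orientation D" and "orientation G"
  shows "orientation (lexicographic_product D G)"
proof -
  interpret D: pair_digraph D using assms by (simp add: orientation_def)
  interpret G: pair_digraph G using assms by (simp add: orientation_def)
  let ?L = "lexicographic_product D G"
  have sub: "parcs ?L \<subseteq> pverts ?L \<times> pverts ?L"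
    by (auto simp: lexicographic_product_def)
  have fin: "finite (pverts ?L)"
    by (simp add: lexicographic_product_def)
  have "pair_digraph ?L"
  proof
    show "finite (parcs ?L)"
      using finite_subset[OF sub] fin by blast
    show "fst e \<noteq> snd e" if "e \<in> parcs ?L" for e
      using that D.no_loops G.no_loops by (fastforce simp: lexicographic_product_def)
  qed (use sub fin in auto)
  moreover have "pverts ?L \<noteq> {}"
    using assms by (auto simp: orientation_def lexicographic_product_def)
  moreover have "\<forall>x y. (x, y) \<in> parcs ?L \<longrightarrow> (y, x) \<notin> parcs ?L"
    using assms by (auto simp: orientation_iff lexicographic_product_def)
  ultimately show ?thesis by (simp add: orientation_iff)
qed

lemma in_nbrs_lexicographic_product:
  assumes "pair_digraph D" and "pair_digraph G" and "v \<in> pverts D" and "i \<in> pverts G"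
  shows "in_nbrs (lexicographic_product D G) (v, i) =
     in_nbrs D v \<times> pverts G \<union> {v} \<times> in_nbrs G i"
proof -
  interpret D: pair_digraph D by fact
  interpret G: pair_digraph G by fact
  show ?thesis
    using assms D.wellformed G.wellformed
    by (force simp: in_nbrs_def lexicographic_product_def)
qed

text \<open>
  No vertex of the copy of \<open>G\<close> at \<open>v\<close> is reached from \<open>(v, i)\<close> by a path through another copy,
  because that would give a directed 2-cycle in \<open>D\<close>.
\<close>

lemma second_out_nbrs_lexicographic_product:
  assumes "orientation D" and "orientation G" and "v \<in> pverts D" and "i \<in> pverts G"
  shows "second_out_nbrs (lexicographic_product D G) (v, i) =
     second_out_nbrs D v \<times> pverts G \<union> {v} \<times> second_out_nbrs G i"
proof -
  interpret D: pair_digraph D using assms by (simp add: orientation_def)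
  interpret G: pair_digraph G using assms by (simp add: orientation_def)
  have D: "u \<in> pverts D \<and> w \<in> pverts D \<and> (w, u) \<notin> parcs D" if "(u, w) \<in> parcs D" for u w
    using assms(1) that D.wellformed by (fastforce simp: orientation_iff)
  have G: "u \<in> pverts G \<and> w \<in> pverts G" if "(u, w) \<in> parcs G" for u w
    using that G.wellformed by fastforce
  \<comment> \<open>A two-arc walk from \<open>(v, i)\<close> that changes copy exactly once ends
    over an out-neighbour of \<open>v\<close>, so at an out-neighbour of \<open>(v, i)\<close>: it
    contributes nothing. Walks inside the copy give the \<open>G\<close> part, walks changing copy
    twice the \<open>D\<close> part. Conversely, a walk in \<open>D\<close> lifts with any vertex of
    \<open>G\<close> at its middle.\<close>
  show ?thesis
    using assms(3,4)
    by (auto simp: second_out_nbrs_def out_nbrs_def lexicographic_product_def dest: D G)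
      (use D G in blast)+
qed

theorem lemma6p5:
  fixes D :: "'a pair_pre_digraph" and G :: "'b pair_pre_digraph"
  assumes "orientation D" and "sullivan_tight D"
    and "orientation G" and "sullivan_tight G"
  shows "orientation (lexicographic_product D G) \<and> sullivan_tight (lexicographic_product D G)"
proof
  show "orientation (lexicographic_product D G)"
    using assms by (simp add: orientation_lexicographic_product)
  interpret D: pair_digraph D using assms by (simp add: orientation_def)
  interpret G: pair_digraph G using assms by (simp add: orientation_def)
  \<comment> \<open>One count serves both neighbourhoods; \<open>v \<notin> A\<close> makes the
    union disjoint.\<close>
  have card: "card (A \<times> pverts G \<union> {v} \<times> B) = card A * card (pverts G) + card B"
    if "A \<subseteq> pverts D" "B \<subseteq> pverts G" "v \<notin> A" for A B v
  proof -
    have "finite A" "finite B" using that D.pair_finite_verts G.pair_finite_verts by (auto intro: finite_subset)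
    with that show ?thesis
      by (subst card_Un_disjoint) (auto simp: card_cartesian_product)
  qed
  \<comment> \<open>Here \<open>v\<close> is excluded because \<open>D\<close> has no loops; for
    \<open>second_out_nbrs\<close> the definition itself excludes it.\<close>
  have in_D: "in_nbrs D v \<subseteq> pverts D" "v \<notin> in_nbrs D v" for v
    using D.wellformed D.no_loops by (fastforce simp: in_nbrs_def)+
  have in_G: "in_nbrs G i \<subseteq> pverts G" for i
    using G.wellformed by (fastforce simp: in_nbrs_def)
  have second_D: "second_out_nbrs D v \<subseteq> pverts D" "v \<notin> second_out_nbrs D v" for v
    by (auto simp: second_out_nbrs_def)
  have second_G: "second_out_nbrs G i \<subseteq> pverts G" for i
    by (auto simp: second_out_nbrs_def)
  show "sullivan_tight (lexicographic_product D G)"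
    unfolding sullivan_tight_def
  proof
    fix x assume "x \<in> pverts (lexicographic_product D G)"
    then obtain v i where x: "x = (v, i)" and v: "v \<in> pverts D" and i: "i \<in> pverts G"
      by (auto simp: lexicographic_product_def)
    have "card (in_nbrs (lexicographic_product D G) x) =
        card (in_nbrs D v) * card (pverts G) + card (in_nbrs G i)"
      by (simp add: x in_nbrs_lexicographic_product[OF D.pair_digraph_axioms G.pair_digraph_axioms v i]
          card in_D in_G)
    also have "\<dots> = card (second_out_nbrs D v) * card (pverts G) + card (second_out_nbrs G i)"
      using assms(2,4) v i by (simp add: sullivan_tight_def)
    also have "\<dots> = card (second_out_nbrs (lexicographic_product D G) x)"
      by (simp add: x second_out_nbrs_lexicographic_product[OF assms(1,3) v i]
          card second_D second_G)
    finally show "card (in_nbrs (lexicographic_product D G) x) =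
        card (second_out_nbrs (lexicographic_product D G) x)" .
  qed
qed

end
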